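(* Consider $\mathsf{CountSketch}$ applied to a vector $x\in\mathbb{R}^U$ with $\ell=5$ rows and $r$ buckets per row, with the median decoder (and fully independent hash values and signs). Then for any distinct $u\neq v\in[U]$, $$\big|\mathbb{E}[\mathrm{err}(u)\cdot\mathrm{err}(v)]\big| \le \frac{70}{r^3}\,\|x\|_1^2 .$$ In particular, setting $r=\lceil 1/\varepsilon\rceil$ for $\varepsilon>0$ gives $|\mathbb{E}[\mathrm{err}(u)\cdot\mathrm{err}(v)]|\le 70\,\varepsilon^3\|x\|_1^2$.
   Context: $\mathsf{CountSketch}$ with $\ell$ rows and $r$ buckets per row: for each row $a\in[\ell]$ there is a hash function $h_a:[U]\to[r]$ and signs $\sigma_{a,w}\in\{-1,1\}$, $w\in[U]$. Full independence is assumed: all hash values $h_a(w)$ ($a\in[\ell]$, $w\in[U]$) are i.i.d. uniform on $[r]$, all signs $\sigma_{a,w}$ are i.i.d. uniform on $\{-1,1\}$, and hashes and signs are mutually independent. The counters are $C_{a,b}=\sum_{w:\,h_a(w)=b}\sigma_{a,w}x_w$. The row estimator of $x_u$ is $\widehat x^{(a)}_u=\sigma_{a,u}C_{a,h_a(u)}$ and the (median-decoded) estimator is $\widehat x_u=\mathrm{median}(\widehat x_u^{(1)},\dots,\widehat x_u^{(\ell)})$. Equivalently, with $$Y_{a,u}:=\sum_{w\ne u:\ h_a(w)=h_a(u)}\sigma_{a,u}\sigma_{a,w}x_w,$$ the error is $\mathrm{err}(u):=\widehat x_u-x_u=\mathrm{median}(Y_{1,u},\dots,Y_{\ell,u})$.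 *)

theory Defs
  imports "HOL-Probability.Probability" "HOL-Probability.Product_PMF"
begin

text \<open>
  The universe [U], the rows and the buckets are the sets {1..U}, {1..l} and {1..r} of natural
  numbers. A vector in R^U is a function x :: nat => real, of which only the values on {1..U} matter.
  An outcome of the sketch is a pair (h, s) of a hash table and a sign table, both indexed by pairs
  (row, item).
\<close>

type_synonym hashes = "nat \<times> nat \<Rightarrow> nat"
type_synonym signs = "nat \<times> nat \<Rightarrow> real"

definition l1_norm :: "nat \<Rightarrow> (nat \<Rightarrow> real) \<Rightarrow> real" where
  "l1_norm U x = (\<Sum>w\<in>{1..U}. \<bar>x w\<bar>)"

text \<open>
  For a list of even length this is the mean of the two middle entries; for odd length the two
  indices coincide.
\<close>

definition median :: "real list \<Rightarrow> real" where
  "median xs = (let ys = sort xs; n = length xs in (ys ! ((n - 1) div 2) + ys ! (n div 2)) / 2)"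

text \<open>
  The second argument of Pi_pmf is the value of the tables outside the index set; it is
  irrelevant here. Only r > 0 is meaningful, as pmf_of_set requires a nonempty set.
\<close>

definition count_sketch_pmf :: "nat \<Rightarrow> nat \<Rightarrow> nat \<Rightarrow> (hashes \<times> signs) pmf" where
  "count_sketch_pmf l r U =
     pair_pmf (Pi_pmf ({1..l} \<times> {1..U}) 0 (\<lambda>_. pmf_of_set {1..r}))
              (Pi_pmf ({1..l} \<times> {1..U}) 0 (\<lambda>_. pmf_of_set {-1, 1}))"

definition counter :: "nat \<Rightarrow> (nat \<Rightarrow> real) \<Rightarrow> hashes \<times> signs \<Rightarrow> nat \<Rightarrow> nat \<Rightarrow> real" where
  "counter U x = (\<lambda>(h, s) a b. \<Sum>w | w \<in> {1..U} \<and> h (a, w) = b. s (a, w) * x w)"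

definition row_estimate :: "nat \<Rightarrow> (nat \<Rightarrow> real) \<Rightarrow> hashes \<times> signs \<Rightarrow> nat \<Rightarrow> nat \<Rightarrow> real" where
  "row_estimate U x = (\<lambda>(h, s) a u. s (a, u) * counter U x (h, s) a (h (a, u)))"

definition estimate :: "nat \<Rightarrow> nat \<Rightarrow> (nat \<Rightarrow> real) \<Rightarrow> hashes \<times> signs \<Rightarrow> nat \<Rightarrow> real" where
  "estimate l U x \<omega> u = median (map (\<lambda>a. row_estimate U x \<omega> a u) [1..<Suc l])"

definition err :: "nat \<Rightarrow> nat \<Rightarrow> (nat \<Rightarrow> real) \<Rightarrow> hashes \<times> signs \<Rightarrow> nat \<Rightarrow> real" where
  "err l U x \<omega> u = estimate l U x \<omega> u - x u"

end

theory Submission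
  imports Defs
begin

text \<open>
  Call a row colliding if it hashes \<open>u\<close> and \<open>v\<close> to the same bucket. If no row is colliding, then
  flipping the signs of \<open>u\<close> in all rows negates \<open>err u\<close> and preserves \<open>err v\<close>, so these outcomes
  contribute nothing. Otherwise, the median of five numbers is dominated in absolute value by at
  least three of them. Hence if row \<open>a\<close> is the only colliding row, then \<open>\<bar>err u\<bar>\<close> and \<open>\<bar>err v\<bar>\<close>
  are controlled by the masses that collide with \<open>u\<close> and with \<open>v\<close> in two distinct further rows;
  if two rows collide, one further row controls \<open>\<bar>err u\<bar>\<close>; if three rows collide, the trivial
  bound suffices. In each case the bound is a sum over triples of distinct rows of products of
  three collision events, which have probability \<open>1 / r ^ 3\<close>. There are 60 ordered triples, with
  weights 1/2, 1/2 and 1/6 for the three cases, and 60 * (7/6) = 70.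
\<close>

section \<open>Medians of lists of odd length\<close>

lemma median_odd:
  assumes "odd (length xs)"
  shows "median xs = sort xs ! (length xs div 2)"
  using assms by (auto simp: median_def Let_def elim!: oddE)

lemma median_map_add:
  assumes "odd (length xs)"
  shows "median (map (\<lambda>y. y + c) xs) = median xs + c"
proof -
  have "sort (map (\<lambda>y. y + c) xs) = map (\<lambda>y. y + c) (sort xs)"
    by (intro properties_for_sort) (simp_all add: sorted_wrt_map)
  moreover obtain k where "length xs = 2 * k + 1"
    using assms by (auto elim: oddE)
  ultimately show ?thesis
    by (simp add: median_odd)
qed

text \<open>Negation reverses the sorted list, and the middle index of a list of length
  \<open>2 * k + 1\<close> is fixed by reversal.\<close>

lemma median_map_uminus:
  assumes "odd (length xs)"
  shows "median (map uminus xs) = - median xs"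
proof -
  have "sort (map uminus xs) = rev (map uminus (sort xs))"
    by (intro properties_for_sort) (simp_all add: sorted_wrt_rev sorted_wrt_map)
  moreover obtain k where "length xs = 2 * k + 1"
    using assms by (auto elim: oddE)
  ultimately show ?thesis
    by (simp add: median_odd rev_nth)
qed

text \<open>A nonnegative median is at most every entry from the middle of the sorted list upwards;
  a negative one is at least every entry up to the middle. Either half, with the middle included,
  has \<open>k + 1\<close> of the \<open>2 * k + 1\<close> positions, and its entries are at least
  as large in absolute value.\<close>

lemma median_dominated:
  assumes "odd (length xs)"
  shows "length xs < 2 * length (filter (\<lambda>y. \<bar>median xs\<bar> \<le> \<bar>y\<bar>) xs)"
proof -
  define ys where "ys = sort xs"
  define m where "m = median xs"
  define F where "F = {i. i < length ys \<and> \<bar>m\<bar> \<le> \<bar>ys ! i\<bar>}"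
  obtain k where k: "length ys = 2 * k + 1"
    using assms by (auto simp: ys_def elim: oddE)
  have m: "m = ys ! k"
    using assms k by (simp add: m_def median_odd ys_def)
  have mono: "ys ! i \<le> ys ! j" if "i \<le> j" "j < length ys" for i j
    using that by (simp add: ys_def sorted_nth_mono)
  have "k < card F"
  proof (cases "m \<ge> 0")
    case True
    have "{k..<2 * k + 1} \<subseteq> F"
      using True mono[of k] by (force simp: F_def k m)
    hence "card {k..<2 * k + 1} \<le> card F"
      by (rule card_mono[rotated]) (simp add: F_def)
    thus ?thesis by simp
  next
    case False
    have "{..k} \<subseteq> F"
      using False mono[of _ k] by (force simp: F_def k m)
    hence "card {..k} \<le> card F"
      by (rule card_mono[rotated]) (simp add: F_def)
    thus ?thesis by simp
  qed
  also have "card F = length (filter (\<lambda>y. \<bar>m\<bar> \<le> \<bar>y\<bar>) ys)"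
    by (simp add: F_def length_filter_conv_card)
  also have "\<dots> = length (filter (\<lambda>y. \<bar>m\<bar> \<le> \<bar>y\<bar>) xs)"
    by (simp add: ys_def filter_sort)
  finally show ?thesis
    using k by (simp add: m_def ys_def)
qed

text \<open>Counting rows instead of values makes ties between rows harmless.\<close>

lemma median_5_dominated:
  "3 \<le> card {i\<in>{1..5::nat}. \<bar>median (map Y [1..<Suc 5])\<bar> \<le> \<bar>Y i\<bar>}" (is "3 \<le> card ?S")
proof -
  let ?P = "\<lambda>i. \<bar>median (map Y [1..<Suc 5])\<bar> \<le> \<bar>Y i\<bar>"
  have "5 < 2 * length (filter ?P [1..<Suc 5])"
    using median_dominated[of "map Y [1..<Suc 5]"] by (simp add: filter_map o_def del: upt_Suc)
  also have "length (filter ?P [1..<Suc 5]) = card (set (filter ?P [1..<Suc 5]))"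
    by (rule distinct_card [symmetric]) simp
  also have "set (filter ?P [1..<Suc 5]) = ?S"
    by (auto simp del: upt_Suc)
  finally show ?thesis by simp
qed

section \<open>Pointwise bound on a product of two medians of five numbers\<close>

definition row_triples :: "(nat \<times> nat \<times> nat) set" where
  "row_triples = (SIGMA a:{1..5}. SIGMA b:{1..5} - {a}. {1..5} - {a, b})"

lemma finite_row_triples: "finite row_triples"
  by (auto simp: row_triples_def)

lemma card_row_triples: "card row_triples = 60"
proof -
  have "card row_triples = (\<Sum>a\<in>{1..5::nat}. \<Sum>b\<in>{1..5::nat} - {a}. card ({1..5::nat} - {a, b}))"
    unfolding row_triples_def by (subst card_SigmaI, simp, simp)+ (rule refl)
  also have "\<dots> = (\<Sum>a\<in>{1..5::nat}. \<Sum>b\<in>{1..5::nat} - {a}. 3)"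
    by (intro sum.cong refl) (subst card_Diff_subset, auto)
  also have "\<dots> = (\<Sum>a\<in>{1..5::nat}. 12)"
    by (intro sum.cong refl) (simp add: card_Diff_singleton)
  finally show ?thesis by simp
qed

text \<open>A deterministic statement, later applied with \<open>K\<close> the set of colliding
  rows, \<open>A\<close> and \<open>B\<close> the masses that collide with \<open>u\<close> and with
  \<open>v\<close>, and \<open>X\<close> the trivial bound. All summands are nonnegative, so it
  suffices to find enough triples: two if \<open>K\<close> has one element, two if it has two, and
  six if it has at least three. The weights 1/2, 1/2 and 1/6 are the reciprocals of these
  numbers.\<close>

lemma abs_median_product_le:
  fixes A B Y Z :: "nat \<Rightarrow> real" and K :: "nat set"
  defines "c \<equiv> \<lambda>i. of_bool (i \<in> K) :: real"
  assumes K: "K \<noteq> {}" "K \<subseteq> {1..5}"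
    and nonneg: "\<And>i. 0 \<le> A i" "\<And>i. 0 \<le> B i" "0 \<le> X"
    and Y: "\<And>i. i \<in> {1..5} \<Longrightarrow> \<bar>Y i\<bar> \<le> X" "\<And>i. i \<in> {1..5} - K \<Longrightarrow> \<bar>Y i\<bar> \<le> A i"
    and Z: "\<And>i. i \<in> {1..5} \<Longrightarrow> \<bar>Z i\<bar> \<le> X" "\<And>i. i \<in> {1..5} - K \<Longrightarrow> \<bar>Z i\<bar> \<le> B i"
  shows "\<bar>median (map Y [1..<Suc 5]) * median (map Z [1..<Suc 5])\<bar> \<le>
    (\<Sum>(a, b, d)\<in>row_triples.
      c a * A b * B d / 2 + X * (c a * c b * A d) / 2 + X\<^sup>2 * (c a * c b * c d) / 6)"
    (is "_ \<le> sum ?g _")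
proof -
  define m n where "m = \<bar>median (map Y [1..<Suc 5])\<bar>" and "n = \<bar>median (map Z [1..<Suc 5])\<bar>"
  define P Q where "P = {i\<in>{1..5}. m \<le> \<bar>Y i\<bar>}" and "Q = {i\<in>{1..5}. n \<le> \<bar>Z i\<bar>}"
  have card_PQ: "3 \<le> card P" "3 \<le> card Q"
    using median_5_dominated[of Y] median_5_dominated[of Z]
    by (simp_all only: P_def Q_def m_def n_def)
  have fin: "finite P" "finite Q" "finite K"
    using K finite_subset by (auto simp: P_def Q_def)
  have mn0: "0 \<le> m" "0 \<le> n" by (simp_all add: m_def n_def)
  \<comment> \<open>Any row in \<open>P\<close> or \<open>Q\<close> carries the trivial bound
    \<open>X\<close> over to the respective median.\<close>
  have "P \<noteq> {}" "Q \<noteq> {}" using card_PQ by auto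
  hence mnX: "m \<le> X" "n \<le> X"
    using Y(1) Z(1) by (fastforce simp: P_def Q_def)+
  have g0: "0 \<le> ?g t" for t
    using nonneg by (auto simp: c_def split: prod.split)
  have le_sum: "sum ?g S \<le> sum ?g row_triples" if "S \<subseteq> row_triples" for S
    using that by (intro sum_mono2 finite_row_triples g0) auto
  have "m * n \<le> sum ?g row_triples"
  proof -
    have "card K \<noteq> 0"
      using K fin by simp
    then consider "card K = 1" | "card K = 2" | "3 \<le> card K"
      by atomize_elim arith
    thus ?thesis
    proof cases
      case 1
      then obtain a where a: "K = {a}" by (auto simp: card_1_singleton_iff)
      have card_Diff: "2 \<le> card (P - {a})" "2 \<le> card (Q - {a})"
        using card_PQ by (auto simp: card_Diff_singleton_if)
      obtain S where "S \<subseteq> P - {a}" "card S = 2" "finite S"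
        by (rule obtain_subset_with_card_n[OF card_Diff(1)])
      moreover obtain T where "T \<subseteq> Q - {a}" "card T = 2" "finite T"
        by (rule obtain_subset_with_card_n[OF card_Diff(2)])
      ultimately obtain i i' j j' where ij: "i \<in> P - {a}" "i' \<in> P - {a}" "i \<noteq> i'"
          "j \<in> Q - {a}" "j' \<in> Q - {a}" "j \<noteq> j'"
        by (auto simp: card_2_iff)
      \<comment> \<open>Each of \<open>i\<close> and \<open>i'\<close> needs a partner in
        \<open>Q\<close> that differs from it; of the two candidates \<open>j\<close> and
        \<open>j'\<close>, at least one does. The partners \<open>k\<close> and \<open>k'\<close>
        may coincide: the triples differ already because \<open>i \<noteq> i'\<close>.\<close>
      define k where "k = (if i = j then j' else j)"
      define k' where "k' = (if i' = j then j' else j)"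
      have kk: "k \<in> Q - {a}" "k' \<in> Q - {a}" "k \<noteq> i" "k' \<noteq> i'"
        using ij by (auto simp: k_def k'_def)
      have prod: "m * n \<le> A s * B t" if "s \<in> P - {a}" "t \<in> Q - {a}" for s t
      proof -
        have "m \<le> A s" "n \<le> B t"
          using that Y(2)[of s] Z(2)[of t] by (auto simp: P_def Q_def a)
        thus ?thesis using mn0 nonneg by (intro mult_mono) auto
      qed
      have "{(a, i, k), (a, i', k')} \<subseteq> row_triples"
        using ij kk K by (auto simp: row_triples_def a P_def Q_def)
      hence "sum ?g {(a, i, k), (a, i', k')} \<le> sum ?g row_triples"
        by (rule le_sum)
      \<comment> \<open>Neither \<open>i\<close> nor \<open>i'\<close> lies in \<open>K\<close>, so
        the second and third parts of \<open>?g\<close> vanish on these triples.\<close>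
      moreover have "sum ?g {(a, i, k), (a, i', k')} = A i * B k / 2 + A i' * B k' / 2"
        using ij kk by (simp add: c_def a)
      ultimately show ?thesis
        using prod[of i k] prod[of i' k'] ij kk by linarith
    next
      case 2
      then obtain a b where ab: "K = {a, b}" "a \<noteq> b" by (auto simp: card_2_iff)
      \<comment> \<open>At least three rows dominate \<open>m\<close> and only two collide, so some
        noncolliding row bounds \<open>m\<close>; for \<open>n\<close> the trivial bound
        suffices.\<close>
      have "\<not> P \<subseteq> K"
        using card_PQ 2 card_mono[of K P] fin by auto
      then obtain d where d: "d \<in> P" "d \<noteq> a" "d \<noteq> b" by (auto simp: ab)
      have "m \<le> A d" using d Y(2)[of d] by (auto simp: P_def ab)
      hence "m * n \<le> A d * X" using mnX mn0 nonneg by (intro mult_mono) auto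
      moreover have "{(a, b, d), (b, a, d)} \<subseteq> row_triples"
        using ab d K by (auto simp: row_triples_def P_def)
      hence "sum ?g {(a, b, d), (b, a, d)} \<le> sum ?g row_triples"
        by (rule le_sum)
      moreover have "A d * X \<le> sum ?g {(a, b, d), (b, a, d)}"
        using ab d nonneg by (simp add: c_def)
      ultimately show ?thesis by linarith
    next
      case 3
      then obtain S where "S \<subseteq> K" "card S = 3" "finite S"
        by (rule obtain_subset_with_card_n)
      then obtain a b d where abd: "{a, b, d} \<subseteq> K" "a \<noteq> b" "a \<noteq> d" "b \<noteq> d"
        by (auto simp: card_3_iff)
      let ?S = "{(a, b, d), (a, d, b), (b, a, d), (b, d, a), (d, a, b), (d, b, a)}"
      have "?S \<subseteq> row_triples"
        using abd K by (auto simp: row_triples_def)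
      hence "sum ?g ?S \<le> sum ?g row_triples"
        by (rule le_sum)
      moreover have "(\<Sum>(a, b, d)\<in>?S. X\<^sup>2 * (c a * c b * c d) / 6) = X\<^sup>2"
        using abd by (simp add: c_def)
      moreover have "(\<Sum>(a, b, d)\<in>?S. X\<^sup>2 * (c a * c b * c d) / 6) \<le> sum ?g ?S"
        using nonneg by (intro sum_mono) (auto simp: c_def)
      moreover have "m * n \<le> X * X"
        using mnX mn0 nonneg by (intro mult_mono) auto
      ultimately show ?thesis by (simp add: power2_eq_square)
    qed
  qed
  thus ?thesis by (simp add: m_def n_def abs_mult)
qed

section \<open>Collision probabilities of independent uniform hash values\<close>

definition hash_pmf :: "'i set \<Rightarrow> nat \<Rightarrow> ('i \<Rightarrow> nat) pmf" where
  "hash_pmf I r = Pi_pmf I 0 (\<lambda>_. pmf_of_set {1..r})"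

lemma set_hash_pmf:
  assumes "finite I" "r \<ge> 1"
  shows "set_pmf (hash_pmf I r) = PiE_dflt I 0 (\<lambda>_. {1..r})"
  using assms by (simp add: hash_pmf_def set_Pi_pmf o_def)

lemma finite_set_hash_pmf:
  assumes "finite I" "r \<ge> 1"
  shows "finite (set_pmf (hash_pmf I r))"
  using assms by (simp add: set_hash_pmf finite_PiE_dflt)

lemma expectation_hash_pmf_insert:
  fixes f :: "('i \<Rightarrow> nat) \<Rightarrow> real"
  assumes "finite J" "p \<notin> J" "r \<ge> 1"
  shows "measure_pmf.expectation (hash_pmf (insert p J) r) f =
    measure_pmf.expectation (hash_pmf J r) (\<lambda>h. \<Sum>y\<in>{1..r}. f (h(p := y))) / r"
proof -
  have fin: "finite (set_pmf (hash_pmf J r))"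
    using assms by (intro finite_set_hash_pmf)
  have "hash_pmf (insert p J) r =
      pmf_of_set {1..r} \<bind> (\<lambda>y. map_pmf (\<lambda>h. h(p := y)) (hash_pmf J r))"
    using assms by (simp add: hash_pmf_def Pi_pmf_insert' map_pmf_def)
  hence "measure_pmf.expectation (hash_pmf (insert p J) r) f =
      (\<Sum>y\<in>{1..r}. measure_pmf.expectation (hash_pmf J r) (\<lambda>h. f (h(p := y))) / r)"
    using assms fin by (simp add: pmf_expectation_bind_pmf_of_set divide_inverse mult.commute)
  also have "\<dots> = measure_pmf.expectation (hash_pmf J r) (\<lambda>h. \<Sum>y\<in>{1..r}. f (h(p := y))) / r"
    using fin by (simp add: sum_divide_distrib integrable_measure_pmf_finite)
  finally show ?thesis .
qed

text \<open>Once all entries but \<open>p\<close> are fixed, \<open>h p\<close> is uniform and meets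
  \<open>h q\<close> with probability \<open>1 / r\<close>. The factor \<open>f\<close> ignores the
  entry at \<open>p\<close>, so it is a constant during this averaging.\<close>

lemma expectation_hash_collision:
  fixes f :: "('i \<Rightarrow> nat) \<Rightarrow> real"
  assumes "finite I" "p \<in> I" "q \<in> I" "p \<noteq> q" "r \<ge> 1"
    and f: "\<And>h y. f (h(p := y)) = f h"
  shows "measure_pmf.expectation (hash_pmf I r) (\<lambda>h. of_bool (h p = h q) * f h) =
    measure_pmf.expectation (hash_pmf I r) f / r"
proof -
  define J where "J = I - {p}"
  have J: "I = insert p J" "finite J" "p \<notin> J" "q \<in> J"
    using assms by (auto simp: J_def)
  have "(\<Sum>y\<in>{1..r}. of_bool ((h(p := y)) p = (h(p := y)) q) * f (h(p := y))) = f h"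
    if "h \<in> set_pmf (hash_pmf J r)" for h
  proof -
    \<comment> \<open>Exactly one value of \<open>y\<close> produces the collision because
      \<open>h q\<close> is a genuine bucket; this uses \<open>q \<in> J\<close>, since the default
      value 0 outside \<open>J\<close> is not one.\<close>
    have "h q \<in> {1..r}"
      using that J assms(5) by (auto simp: set_hash_pmf PiE_dflt_def)
    thus ?thesis
      using assms(4) by (simp add: f of_bool_def if_distrib[of "\<lambda>b. b * _"] sum.delta cong: if_cong)
  qed
  hence "measure_pmf.expectation (hash_pmf J r)
      (\<lambda>h. \<Sum>y\<in>{1..r}. of_bool ((h(p := y)) p = (h(p := y)) q) * f (h(p := y))) =
      measure_pmf.expectation (hash_pmf J r) f"
    by (intro integral_cong_AE) (auto simp: AE_measure_pmf_iff)
  thus ?thesis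
    using J assms(5) by (simp add: expectation_hash_pmf_insert f del: fun_upd_apply)
qed

text \<open>The collision events are peeled off one at a time. As the rows are distinct, the entry
  being averaged never occurs in the remaining factors, even if the same items reappear in other
  rows.\<close>

lemma expectation_three_collisions:
  fixes a b d :: nat
  assumes "finite I" "r \<ge> 1" "a \<noteq> b" "a \<noteq> d" "b \<noteq> d"
    and "w1 \<noteq> z1" "w2 \<noteq> z2" "w3 \<noteq> z3"
    and "{(a, w1), (a, z1), (b, w2), (b, z2), (d, w3), (d, z3)} \<subseteq> I"
  shows "measure_pmf.expectation (hash_pmf I r)
    (\<lambda>h. of_bool (h (a, w1) = h (a, z1)) * of_bool (h (b, w2) = h (b, z2)) *
      of_bool (h (d, w3) = h (d, z3))) = 1 / real r ^ 3"
proof -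
  let ?E = "measure_pmf.expectation (hash_pmf I r)"
  let ?c = "\<lambda>i w z h. of_bool (h (i, w) = h (i, z)) :: real"
  have "?E (\<lambda>h. ?c a w1 z1 h * (?c b w2 z2 h * ?c d w3 z3 h)) =
      ?E (\<lambda>h. ?c b w2 z2 h * ?c d w3 z3 h) / real r"
    using assms by (intro expectation_hash_collision) auto
  also have "?E (\<lambda>h. ?c b w2 z2 h * ?c d w3 z3 h) = ?E (?c d w3 z3) / real r"
    using assms by (intro expectation_hash_collision) auto
  also have "?E (?c d w3 z3) = ?E (\<lambda>h. ?c d w3 z3 h * 1)"
    by simp
  also have "\<dots> = ?E (\<lambda>_. 1) / real r"
    using assms by (intro expectation_hash_collision) auto
  finally show ?thesis
    by (simp add: power3_eq_cube mult.assoc)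
qed

section \<open>Sign flips and the cancellation of collision-free outcomes\<close>

definition flip_signs :: "nat \<Rightarrow> signs \<Rightarrow> signs" where
  "flip_signs u s = (\<lambda>p. if snd p = u then - s p else s p)"

lemma flip_signs_flip_signs [simp]: "flip_signs u (flip_signs u s) = s"
  by (auto simp: flip_signs_def)

text \<open>The sign table is uniform on a finite set of functions, and an involution of that set
  preserves the uniform distribution.\<close>

lemma map_pmf_flip_signs:
  assumes "finite I"
  shows "map_pmf (flip_signs u) (Pi_pmf I 0 (\<lambda>_. pmf_of_set {-1, 1})) =
    Pi_pmf I 0 (\<lambda>_. pmf_of_set {-1, 1})"
proof -
  let ?E = "PiE_dflt I (0::real) (\<lambda>_. {-1, 1})"
  \<comment> \<open>Outside \<open>I\<close> the default value 0 is its own negative, so the flip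
    keeps the table in \<open>?E\<close>.\<close>
  have "flip_signs u s \<in> ?E" if "s \<in> ?E" for s
    using that by (force simp: PiE_dflt_def flip_signs_def)
  hence "bij_betw (flip_signs u) ?E ?E"
    by (intro bij_betwI[where g = "flip_signs u"]) auto
  thus ?thesis
    using assms by (simp add: Pi_pmf_of_set map_pmf_of_set_bij_betw finite_PiE_dflt)
qed

lemma map_pmf_count_sketch_flip:
  "map_pmf (map_prod id (flip_signs u)) (count_sketch_pmf l r U) = count_sketch_pmf l r U"
  unfolding count_sketch_pmf_def map_prod_def by (subst map_pair) (simp add: map_pmf_flip_signs)

definition row_err :: "nat \<Rightarrow> (nat \<Rightarrow> real) \<Rightarrow> hashes \<times> signs \<Rightarrow> nat \<Rightarrow> nat \<Rightarrow> real" where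
  "row_err U x = (\<lambda>(h, s) u a.
    \<Sum>w | w \<in> {1..U} - {u} \<and> h (a, w) = h (a, u). s (a, u) * s (a, w) * x w)"

lemma set_count_sketch_pmf:
  assumes "(h, s) \<in> set_pmf (count_sketch_pmf l r U)" "a \<in> {1..l}" "w \<in> {1..U}"
  shows "s (a, w) \<in> {-1, 1}"
  using assms by (auto simp: count_sketch_pmf_def set_Pi_pmf PiE_dflt_def)

lemma finite_set_count_sketch_pmf:
  assumes "r \<ge> 1"
  shows "finite (set_pmf (count_sketch_pmf l r U))"
  using assms by (auto simp: count_sketch_pmf_def set_Pi_pmf intro!: finite_PiE_dflt)

text \<open>The item \<open>u\<close> itself contributes \<open>x u\<close> to the estimate, since
  its sign squares to 1; this is why the outcome must lie in the support.\<close>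

lemma row_estimate_eq:
  assumes "(h, s) \<in> set_pmf (count_sketch_pmf l r U)" "a \<in> {1..l}" "u \<in> {1..U}"
  shows "row_estimate U x (h, s) a u = row_err U x (h, s) u a + x u"
proof -
  let ?S = "{w \<in> {1..U} - {u}. h (a, w) = h (a, u)}"
  have "{w \<in> {1..U}. h (a, w) = h (a, u)} = insert u ?S"
    using assms by auto
  moreover have "s (a, u) * s (a, u) = 1"
    using set_count_sketch_pmf[OF assms] by auto
  ultimately show ?thesis
    by (simp add: row_estimate_def counter_def row_err_def distrib_left sum_distrib_left
        mult.assoc [symmetric])
qed

lemma err_eq_median_row_err:
  assumes "\<omega> \<in> set_pmf (count_sketch_pmf l r U)" "u \<in> {1..U}" "odd l"
  shows "err l U x \<omega> u = median (map (row_err U x \<omega> u) [1..<Suc l])"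
proof -
  obtain h s where \<omega>: "\<omega> = (h, s)" by fastforce
  have eq: "map (\<lambda>a. row_estimate U x \<omega> a u) [1..<Suc l] =
      map (\<lambda>y. y + x u) (map (row_err U x \<omega> u) [1..<Suc l])"
    using assms by (auto simp: \<omega> row_estimate_eq simp del: upt_Suc)
  thus ?thesis
    unfolding err_def estimate_def eq using assms(3)
    by (subst median_map_add) (simp_all del: upt_Suc)
qed

lemma row_err_flip_self:
  "row_err U x (h, flip_signs u s) u a = - row_err U x (h, s) u a"
  by (auto simp: row_err_def flip_signs_def sum_negf [symmetric] intro!: sum.cong)

text \<open>In a row that separates \<open>u\<close> and \<open>v\<close>, the item \<open>u\<close>
  is not in the bucket of \<open>v\<close>, so no flipped sign enters the sum.\<close>

lemma row_err_flip_other: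
  assumes "u \<noteq> v" "h (a, u) \<noteq> h (a, v)"
  shows "row_err U x (h, flip_signs u s) v a = row_err U x (h, s) v a"
  using assms by (auto simp: row_err_def flip_signs_def intro!: sum.cong)

text \<open>The flip preserves the distribution and, leaving the hashes alone, also the
  collision-free event, but it negates the integrand. The expectation is thus its own
  negative.\<close>

lemma expectation_err_no_collision:
  assumes "u \<in> {1..U}" "v \<in> {1..U}" "u \<noteq> v" "odd l"
  shows "measure_pmf.expectation (count_sketch_pmf l r U)
    (\<lambda>\<omega>. of_bool (\<forall>a\<in>{1..l}. fst \<omega> (a, u) \<noteq> fst \<omega> (a, v)) * (err l U x \<omega> u * err l U x \<omega> v)) = 0"
    (is "measure_pmf.expectation ?M ?f = 0")
proof -
  let ?\<phi> = "map_prod id (flip_signs u)"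
  have "?f (?\<phi> \<omega>) = - ?f \<omega>" if \<omega>: "\<omega> \<in> set_pmf ?M" for \<omega>
  proof -
    obtain h s where hs: "\<omega> = (h, s)" by fastforce
    \<comment> \<open>The flipped outcome must also lie in the support, for its error to be a median
      of row errors.\<close>
    have \<phi>: "?\<phi> \<omega> \<in> set_pmf ?M"
      using \<omega> by (subst map_pmf_count_sketch_flip[of u, symmetric]) auto
    have u: "err l U x (?\<phi> \<omega>) u = - err l U x \<omega> u"
    proof -
      have eq: "map (row_err U x (?\<phi> \<omega>) u) [1..<Suc l] =
          map uminus (map (row_err U x \<omega> u) [1..<Suc l])"
        by (simp add: hs row_err_flip_self del: upt_Suc)
      thus ?thesis
        unfolding err_eq_median_row_err[OF \<phi> assms(1,4)] err_eq_median_row_err[OF \<omega> assms(1,4)] eq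
        using assms(4) by (subst median_map_uminus) (simp_all del: upt_Suc)
    qed
    have v: "err l U x (?\<phi> \<omega>) v = err l U x \<omega> v"
      if "\<forall>a\<in>{1..l}. h (a, u) \<noteq> h (a, v)"
    proof -
      have eq: "map (row_err U x (?\<phi> \<omega>) v) [1..<Suc l] = map (row_err U x \<omega> v) [1..<Suc l]"
        using that assms(3) by (auto simp: hs row_err_flip_other simp del: upt_Suc)
      show ?thesis
        unfolding err_eq_median_row_err[OF \<phi> assms(2,4)] err_eq_median_row_err[OF \<omega> assms(2,4)] eq ..
    qed
    show ?thesis using u v by (auto simp: hs)
  qed
  hence "measure_pmf.expectation ?M (\<lambda>\<omega>. ?f (?\<phi> \<omega>)) = measure_pmf.expectation ?M (\<lambda>\<omega>. - ?f \<omega>)"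
    by (intro integral_cong_AE) (auto simp: AE_measure_pmf_iff)
  moreover have "measure_pmf.expectation ?M (\<lambda>\<omega>. ?f (?\<phi> \<omega>)) = measure_pmf.expectation ?M ?f"
    by (subst (2) map_pmf_count_sketch_flip[of u, symmetric]) simp
  ultimately show ?thesis by simp
qed

section \<open>Collision masses and the expectation of a single triple\<close>

definition collision_mass ::
    "nat \<Rightarrow> (nat \<Rightarrow> real) \<Rightarrow> nat \<Rightarrow> nat \<Rightarrow> hashes \<Rightarrow> nat \<Rightarrow> real" where
  "collision_mass U x u v h a =
    (\<Sum>w\<in>{1..U} - {u, v}. of_bool (h (a, w) = h (a, u)) * \<bar>x w\<bar>)"

lemma collision_mass_nonneg: "0 \<le> collision_mass U x u v h a"
  by (simp add: collision_mass_def sum_nonneg)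

lemma abs_row_err_le_sum:
  assumes "(h, s) \<in> set_pmf (count_sketch_pmf l r U)" "a \<in> {1..l}" "u \<in> {1..U}"
  shows "\<bar>row_err U x (h, s) u a\<bar> \<le> (\<Sum>w | w \<in> {1..U} - {u} \<and> h (a, w) = h (a, u). \<bar>x w\<bar>)"
proof -
  have "\<bar>s (a, w)\<bar> = 1" if "w \<in> {1..U}" for w
    using set_count_sketch_pmf[OF assms(1,2) that] by auto
  thus ?thesis
    unfolding row_err_def prod.case using assms(3)
    by (intro order_trans[OF sum_abs] sum_mono) (auto simp: abs_mult)
qed

lemma abs_row_err_le_l1_norm:
  assumes "(h, s) \<in> set_pmf (count_sketch_pmf l r U)" "a \<in> {1..l}" "u \<in> {1..U}"
  shows "\<bar>row_err U x (h, s) u a\<bar> \<le> l1_norm U x"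
  unfolding l1_norm_def by (rule order_trans[OF abs_row_err_le_sum[OF assms] sum_mono2]) auto

text \<open>In a row that separates \<open>u\<close> and \<open>v\<close>, the item \<open>v\<close>
  does not share the bucket of \<open>u\<close>, so omitting it from the collision mass loses
  nothing.\<close>

lemma abs_row_err_le_collision_mass:
  assumes "(h, s) \<in> set_pmf (count_sketch_pmf l r U)" "a \<in> {1..l}" "u \<in> {1..U}"
    and "h (a, u) \<noteq> h (a, v)"
  shows "\<bar>row_err U x (h, s) u a\<bar> \<le> collision_mass U x u v h a"
proof -
  have "(\<Sum>w | w \<in> {1..U} - {u} \<and> h (a, w) = h (a, u). \<bar>x w\<bar>) = collision_mass U x u v h a"
    unfolding collision_mass_def using assms(4)
    by (intro sum.mono_neutral_cong_left) auto
  thus ?thesis using abs_row_err_le_sum[OF assms(1-3), of x] by simp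
qed

lemma sum_abs_le_l1_norm: "(\<Sum>w\<in>{1..U} - S. \<bar>x w\<bar>) \<le> l1_norm U x"
  unfolding l1_norm_def by (intro sum_mono2) auto

lemma l1_norm_nonneg: "0 \<le> l1_norm U x"
  by (simp add: l1_norm_def sum_nonneg)

text \<open>Expanding the masses turns each summand into a combination of products of three
  collision indicators in distinct rows, each of expectation \<open>1 / r ^ 3\<close>. The
  coefficients add up to at most \<open>X\<^sup>2\<close> times the weight, and 1/2 + 1/2 + 1/6 =
  7/6.\<close>

lemma expectation_triple_bound:
  fixes U r u v :: nat and x :: "nat \<Rightarrow> real"
  defines "X \<equiv> l1_norm U x"
  defines "c \<equiv> \<lambda>h a. of_bool (h (a, u) = h (a, v)) :: real"
  assumes "r \<ge> 1" "u \<in> {1..U}" "v \<in> {1..U}" "u \<noteq> v"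
    and abd: "(a, b, d) \<in> row_triples"
  shows "measure_pmf.expectation (hash_pmf ({1..5::nat} \<times> {1..U}) r) (\<lambda>h.
      c h a * collision_mass U x u v h b * collision_mass U x v u h d / 2 +
      X * (c h a * c h b * collision_mass U x u v h d) / 2 +
      X\<^sup>2 * (c h a * c h b * c h d) / 6) \<le> 7 / 6 * (X\<^sup>2 / real r ^ 3)"
proof -
  define M where "M = hash_pmf ({1..5::nat} \<times> {1..U}) r"
  let ?E = "measure_pmf.expectation M"
  let ?W = "{1..U} - {u, v}"
  have int: "integrable M f" for f :: "_ \<Rightarrow> real"
    unfolding M_def using assms by (intro integrable_measure_pmf_finite finite_set_hash_pmf) auto
  have X0: "0 \<le> X" by (simp add: X_def l1_norm_nonneg)
  have WX: "(\<Sum>w\<in>?W. \<bar>x w\<bar>) \<le> X" unfolding X_def by (rule sum_abs_le_l1_norm)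
  have W0: "0 \<le> (\<Sum>w\<in>?W. \<bar>x w\<bar>)" by (simp add: sum_nonneg)
  have three: "?E (\<lambda>h. of_bool (h (a, w1) = h (a, z1)) * of_bool (h (b, w2) = h (b, z2)) *
      of_bool (h (d, w3) = h (d, z3))) = 1 / real r ^ 3"
    if "w1 \<noteq> z1" "w2 \<noteq> z2" "w3 \<noteq> z3" "{w1, z1, w2, z2, w3, z3} \<subseteq> {1..U}" for w1 z1 w2 z2 w3 z3
    unfolding M_def using that abd assms(3) by (intro expectation_three_collisions) (auto simp: row_triples_def)
  have E1: "?E (\<lambda>h. c h a * collision_mass U x u v h b * collision_mass U x v u h d) \<le> X\<^sup>2 / real r ^ 3"
  proof -
    have "?E (\<lambda>h. c h a * collision_mass U x u v h b * collision_mass U x v u h d) =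
      ?E (\<lambda>h. \<Sum>w\<in>?W. \<Sum>w'\<in>?W. \<bar>x w\<bar> * \<bar>x w'\<bar> * (of_bool (h (a, u) = h (a, v)) *
        of_bool (h (b, w) = h (b, u)) * of_bool (h (d, w') = h (d, v))))"
    proof (rule arg_cong[where f = ?E], rule ext)
      fix h :: hashes
      \<comment> \<open>Both masses range over the same items \<open>?W\<close>, as the set
        \<open>{u, v}\<close> is symmetric.\<close>
      have swap: "collision_mass U x v u h d = (\<Sum>w\<in>?W. of_bool (h (d, w) = h (d, v)) * \<bar>x w\<bar>)"
        by (simp only: collision_mass_def insert_commute)
      show "c h a * collision_mass U x u v h b * collision_mass U x v u h d =
        (\<Sum>w\<in>?W. \<Sum>w'\<in>?W. \<bar>x w\<bar> * \<bar>x w'\<bar> * (of_bool (h (a, u) = h (a, v)) *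
          of_bool (h (b, w) = h (b, u)) * of_bool (h (d, w') = h (d, v))))"
        unfolding swap unfolding collision_mass_def c_def mult.assoc
        unfolding sum_product unfolding sum_distrib_left
        by (intro sum.cong refl) (simp only: mult_ac)
    qed
    also have "\<dots> = (\<Sum>w\<in>?W. \<Sum>w'\<in>?W. \<bar>x w\<bar> * \<bar>x w'\<bar> * ?E (\<lambda>h. of_bool (h (a, u) = h (a, v)) *
        of_bool (h (b, w) = h (b, u)) * of_bool (h (d, w') = h (d, v))))"
      by (simp add: int)
    also have "\<dots> = (\<Sum>w\<in>?W. \<Sum>w'\<in>?W. \<bar>x w\<bar> * \<bar>x w'\<bar> * (1 / real r ^ 3))"
      using assms(4-6) by (intro sum.cong refl arg_cong2[where f = "(*)"] three) auto
    also have "\<dots> = (\<Sum>w\<in>?W. \<bar>x w\<bar>)\<^sup>2 / real r ^ 3"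
      by (simp add: power2_eq_square sum_product sum_divide_distrib)
    also have "\<dots> \<le> X\<^sup>2 / real r ^ 3"
      using WX W0 by (intro divide_right_mono power_mono) auto
    finally show ?thesis .
  qed
  have E2: "?E (\<lambda>h. c h a * c h b * collision_mass U x u v h d) \<le> X / real r ^ 3"
  proof -
    have "?E (\<lambda>h. c h a * c h b * collision_mass U x u v h d) =
      ?E (\<lambda>h. \<Sum>w\<in>?W. \<bar>x w\<bar> * (of_bool (h (a, u) = h (a, v)) *
        of_bool (h (b, u) = h (b, v)) * of_bool (h (d, w) = h (d, u))))"
      unfolding collision_mass_def c_def sum_distrib_left by (simp only: mult_ac)
    also have "\<dots> = (\<Sum>w\<in>?W. \<bar>x w\<bar> * ?E (\<lambda>h. of_bool (h (a, u) = h (a, v)) *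
        of_bool (h (b, u) = h (b, v)) * of_bool (h (d, w) = h (d, u))))"
      by (simp add: int)
    also have "\<dots> = (\<Sum>w\<in>?W. \<bar>x w\<bar> * (1 / real r ^ 3))"
      using assms(4-6) by (intro sum.cong refl arg_cong2[where f = "(*)"] three) auto
    also have "\<dots> \<le> X / real r ^ 3"
      using WX by (simp add: sum_divide_distrib [symmetric] divide_right_mono)
    finally show ?thesis .
  qed
  have E3: "?E (\<lambda>h. c h a * c h b * c h d) = 1 / real r ^ 3"
    unfolding c_def using assms(4-6) by (intro three) auto
  have "?E (\<lambda>h. c h a * collision_mass U x u v h b * collision_mass U x v u h d / 2 +
      X * (c h a * c h b * collision_mass U x u v h d) / 2 + X\<^sup>2 * (c h a * c h b * c h d) / 6) =
    ?E (\<lambda>h. c h a * collision_mass U x u v h b * collision_mass U x v u h d) / 2 +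
    X * ?E (\<lambda>h. c h a * c h b * collision_mass U x u v h d) / 2 +
    X\<^sup>2 * ?E (\<lambda>h. c h a * c h b * c h d) / 6"
    by (simp add: int)
  also have "\<dots> \<le> X\<^sup>2 / real r ^ 3 / 2 + X * (X / real r ^ 3) / 2 + X\<^sup>2 * (1 / real r ^ 3) / 6"
    using E1 E2 X0 by (intro add_mono divide_right_mono mult_left_mono) (auto simp: E3)
  also have "\<dots> = 7 / 6 * (X\<^sup>2 / real r ^ 3)"
    by (simp add: power2_eq_square)
  finally show ?thesis by (simp only: M_def)
qed

section \<open>The bound on the expected product of errors\<close>

lemma abs_expectation_err_product_le:
  fixes U r u v :: nat and x :: "nat \<Rightarrow> real"
  assumes "r \<ge> 1" "u \<in> {1..U}" "v \<in> {1..U}" "u \<noteq> v"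
  shows "\<bar>measure_pmf.expectation (count_sketch_pmf 5 r U) (\<lambda>\<omega>. err 5 U x \<omega> u * err 5 U x \<omega> v)\<bar>
    \<le> 70 / real r ^ 3 * (l1_norm U x)\<^sup>2"
proof -
  let ?M = "count_sketch_pmf 5 r U"
  let ?E = "measure_pmf.expectation ?M"
  define X where "X = l1_norm U x"
  define c where "c = (\<lambda>(h::hashes) a. of_bool (h (a, u) = h (a, v)) :: real)"
  define g where "g = (\<lambda>h (a, b, d). c h a * collision_mass U x u v h b * collision_mass U x v u h d / 2 +
      X * (c h a * c h b * collision_mass U x u v h d) / 2 + X\<^sup>2 * (c h a * c h b * c h d) / 6)"
  define e where "e = (\<lambda>\<omega>. err 5 U x \<omega> u * err 5 U x \<omega> v)"
  define free where "free = (\<lambda>\<omega>::hashes \<times> signs. \<forall>a\<in>{1..5}. fst \<omega> (a, u) \<noteq> fst \<omega> (a, v))"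
  have int: "integrable ?M f" for f :: "_ \<Rightarrow> real"
    using assms by (intro integrable_measure_pmf_finite finite_set_count_sketch_pmf) auto
  have odd5: "odd (5::nat)" by simp
  have pointwise: "\<bar>of_bool (\<not> free \<omega>) * e \<omega>\<bar> \<le> sum (g (fst \<omega>)) row_triples"
    if \<omega>: "\<omega> \<in> set_pmf ?M" for \<omega>
  proof -
    obtain h s where hs: "\<omega> = (h, s)" by fastforce
    define K where "K = {a\<in>{1..5}. h (a, u) = h (a, v)}"
    have rowu: "\<bar>row_err U x (h, s) u i\<bar> \<le> X" "\<bar>row_err U x (h, s) v i\<bar> \<le> X" if "i \<in> {1..5}" for i
      using abs_row_err_le_l1_norm that assms \<omega> by (auto simp: hs X_def)
    have rowA: "\<bar>row_err U x (h, s) u i\<bar> \<le> collision_mass U x u v h i"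
        "\<bar>row_err U x (h, s) v i\<bar> \<le> collision_mass U x v u h i" if "i \<in> {1..5} - K" for i
      using that assms \<omega> by (auto simp: hs K_def intro!: abs_row_err_le_collision_mass)
    show ?thesis
    \<comment> \<open>On collision-free outcomes the left-hand side is 0 and only nonnegativity of
      \<open>g\<close> is needed.\<close>
    proof (cases "free \<omega>")
      case True
      have "0 \<le> g h t" for t
        by (auto simp: g_def c_def X_def collision_mass_nonneg l1_norm_nonneg split: prod.split)
      thus ?thesis using True by (simp add: hs sum_nonneg)
    next
      case False
      hence "K \<noteq> {}" "K \<subseteq> {1..5}" by (auto simp: free_def hs K_def)
      hence "\<bar>e \<omega>\<bar> \<le> (\<Sum>(a, b, d)\<in>row_triples.
          of_bool (a \<in> K) * collision_mass U x u v h b * collision_mass U x v u h d / 2 +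
          X * (of_bool (a \<in> K) * of_bool (b \<in> K) * collision_mass U x u v h d) / 2 +
          X\<^sup>2 * (of_bool (a \<in> K) * of_bool (b \<in> K) * of_bool (d \<in> K)) / 6)"
        unfolding e_def err_eq_median_row_err[OF \<omega> assms(2) odd5] err_eq_median_row_err[OF \<omega> assms(3) odd5]
        unfolding hs
        by (intro abs_median_product_le collision_mass_nonneg rowu rowA)
          (simp_all add: X_def l1_norm_nonneg)
      also have "\<dots> = sum (g h) row_triples"
        by (intro sum.cong) (auto simp: g_def c_def K_def row_triples_def)
      finally show ?thesis using False by (simp add: hs)
    qed
  qed
  have "?E e = ?E (\<lambda>\<omega>. of_bool (free \<omega>) * e \<omega> + of_bool (\<not> free \<omega>) * e \<omega>)"
    by (intro Bochner_Integration.integral_cong) auto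
  \<comment> \<open>The collision-free part cancels in expectation. This has to happen before
    absolute values are taken.\<close>
  also have "\<dots> = ?E (\<lambda>\<omega>. of_bool (\<not> free \<omega>) * e \<omega>)"
    using expectation_err_no_collision[of u U v 5 r x] assms(2-4)
    by (simp add: Bochner_Integration.integral_add[OF int int] e_def free_def)
  finally have "\<bar>?E e\<bar> \<le> ?E (\<lambda>\<omega>. \<bar>of_bool (\<not> free \<omega>) * e \<omega>\<bar>)"
    by (simp only: integral_abs_bound)
  also have "\<dots> \<le> ?E (\<lambda>\<omega>. sum (g (fst \<omega>)) row_triples)"
    by (intro integral_mono_AE int) (auto simp: AE_measure_pmf_iff pointwise)
  also have "\<dots> = (\<Sum>t\<in>row_triples. ?E (\<lambda>\<omega>. g (fst \<omega>) t))"
    by (simp add: int)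
  also have "\<dots> = (\<Sum>t\<in>row_triples. measure_pmf.expectation (map_pmf fst ?M) (\<lambda>h. g h t))"
    by simp
  \<comment> \<open>The pointwise bound no longer involves the signs, so only the marginal
    distribution of the hashes matters.\<close>
  also have "map_pmf fst ?M = hash_pmf ({1..5} \<times> {1..U}) r"
    by (simp add: count_sketch_pmf_def hash_pmf_def map_fst_pair_pmf)
  also have "(\<Sum>t\<in>row_triples. measure_pmf.expectation (hash_pmf ({1..5::nat} \<times> {1..U}) r) (\<lambda>h. g h t))
      \<le> (\<Sum>t\<in>row_triples. 7 / 6 * (X\<^sup>2 / real r ^ 3))"
  proof (rule sum_mono)
    fix t assume "t \<in> row_triples"
    moreover obtain a b d where "t = (a, b, d)" by (cases t)
    ultimately show "measure_pmf.expectation (hash_pmf ({1..5::nat} \<times> {1..U}) r) (\<lambda>h. g h t)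
        \<le> 7 / 6 * (X\<^sup>2 / real r ^ 3)"
      using expectation_triple_bound[OF assms, of a b d x] by (simp add: g_def c_def X_def)
  qed
  \<comment> \<open>60 triples, each contributing 7/6.\<close>
  also have "\<dots> = 70 / real r ^ 3 * X\<^sup>2"
    by (simp add: card_row_triples)
  finally show ?thesis by (simp add: e_def X_def)
qed

theorem theoremA1:
  fixes U r u v :: nat and x :: "nat \<Rightarrow> real"
  assumes "r \<ge> 1" and "u \<in> {1..U}" and "v \<in> {1..U}" and "u \<noteq> v"
  shows "\<bar>measure_pmf.expectation (count_sketch_pmf 5 r U) (\<lambda>\<omega>. err 5 U x \<omega> u * err 5 U x \<omega> v)\<bar>
           \<le> 70 / real r ^ 3 * (l1_norm U x)\<^sup>2 \<and>
         (\<forall>\<epsilon>::real. \<epsilon> > 0 \<longrightarrow> int r = \<lceil>1 / \<epsilon>\<rceil> \<longrightarrow>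
           \<bar>measure_pmf.expectation (count_sketch_pmf 5 r U) (\<lambda>\<omega>. err 5 U x \<omega> u * err 5 U x \<omega> v)\<bar>
             \<le> 70 * \<epsilon> ^ 3 * (l1_norm U x)\<^sup>2)"
proof (intro conjI allI impI)
  fix \<epsilon> :: real
  assume \<epsilon>: "\<epsilon> > 0" "int r = \<lceil>1 / \<epsilon>\<rceil>"
  \<comment> \<open>Rounding up makes \<open>r\<close> at least \<open>1 / \<epsilon>\<close>, so
    the bound in \<open>r\<close> can only be smaller than the one in
    \<open>\<epsilon>\<close>.\<close>
  have "1 / \<epsilon> \<le> real r"
    using \<epsilon>(2) le_of_int_ceiling[of "1 / \<epsilon>"] by (metis of_int_of_nat_eq)
  hence "1 / real r \<le> \<epsilon>"
    using \<epsilon>(1) assms(1) by (simp add: field_simps)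
  hence "(1 / real r) ^ 3 \<le> \<epsilon> ^ 3"
    by (intro power_mono) auto
  hence "70 / real r ^ 3 * (l1_norm U x)\<^sup>2 \<le> 70 * \<epsilon> ^ 3 * (l1_norm U x)\<^sup>2"
    by (intro mult_right_mono) (auto simp: power_divide)
  with abs_expectation_err_product_le[OF assms, of x]
  show "\<bar>measure_pmf.expectation (count_sketch_pmf 5 r U) (\<lambda>\<omega>. err 5 U x \<omega> u * err 5 U x \<omega> v)\<bar>
      \<le> 70 * \<epsilon> ^ 3 * (l1_norm U x)\<^sup>2"
    by linarith
qed (rule abs_expectation_err_product_le[OF assms])

end
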